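(* Let $q>\varphi=\frac{1+\sqrt5}{2}$ and let $k\ge k(q)$ be an integer. Then for every $\mathbf u_k\in\{0,1\}^k$ the map $G_{q,\mathbf u_k}:\mathbb R^2\to\mathbb R^2$ is a contraction, and $$\bigcup_{\mathbf u_k\in\{0,1\}^k}G_{q,\mathbf u_k}(Q_\infty)=Q_\infty .$$ Moreover $Q_\infty$ is the attractor of the two-dimensional linear iterated function system $\mathcal G_{q,k}=\{G_{q,\mathbf u_k}\mid\mathbf u_k\in\{0,1\}^k\}$, namely for every non-empty compact set $X\subset\mathbb R^2$ one has $$\lim_{n\to\infty}\mathcal G_{q,k}^n(X)=Q_\infty .$$
   Context: $(f_n)_{n\ge 0}$ is the Fibonacci sequence with $f_0=f_1=1$ and $f_{n+2}=f_{n+1}+f_n$. Set $$A(q)=\begin{pmatrix}\frac1q&\frac1{q^2}\\ 1&0\end{pmatrix}.$$ For $q>\varphi$ the spectral radius of $A(q)$ is $\varphi/q<1$, so $A(q)^m\to0$ as $m\to\infty$; $k(q)$ denotes a positive integer such that $\|A(q)^m\|<1$ for every integer $m\ge k(q)$, where $\|M\|=\max_{\mathbf x\ne0}\|M\mathbf x\|/\|\mathbf x\|$ is the operator norm for the Euclidean norm on $\mathbb R^2$. For $\mathbf u_k=(u_2,u_3,\dots,u_{k+1})\in\{0,1\}^k$ and $\mathbf x\in\mathbb R^2$, $$G_{q,\mathbf u_k}(\mathbf x)=\sum_{h=0}^{k-1}A(q)^h\begin{pmatrix}u_{k+1-h}\\0\end{pmatrix}+A(q)^k\mathbf x .$$ The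 set $Q_\infty=Q_\infty(q)\subset\mathbb R^2$ is $$Q_\infty=\left\{\left(\sum_{j=0}^\infty\frac{f_j}{q^j}u_j,\;\sum_{j=0}^\infty\frac{f_j}{q^j}u_{j+1}\right)\;\middle|\;(u_0,u_1,u_2,\dots)\in\{0,1\}^\infty\right\}.$$ A contraction is a map $G$ for which there is $c<1$ with $\|G(\mathbf x)-G(\mathbf y)\|\le c\|\mathbf x-\mathbf y\|$ for all $\mathbf x,\mathbf y$. For a set $X\subset\mathbb R^2$, $\mathcal G_{q,k}(X)=\bigcup_{\mathbf u_k\in\{0,1\}^k}G_{q,\mathbf u_k}(X)$ is the Hutchinson operator of the system and $\mathcal G_{q,k}^n$ is its $n$-th iterate. The attractor of a finite system of contractions is the unique non-empty compact set fixed by its Hutchinson operator. Limits of sets are in the Hausdorff metric on non-empty compact sets. *)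

theory Defs
  imports "HOL-Analysis.Analysis" "HOL-Number_Theory.Fib"
begin

definition A :: "real \<Rightarrow> real^2^2" where
  "A q = vector [vector [1 / q, 1 / q^2], vector [1, 0]]"

(* The type-class power on vectors is componentwise, so the matrix power needs its own name. *)
primrec mpow :: "real^'n^'n \<Rightarrow> nat \<Rightarrow> real^'n^'n" where
  "mpow M 0 = mat 1"
| "mpow M (Suc m) = M ** mpow M m"

(* Words (u_2, ..., u_{k+1}) over {0,1}, as functions that are undefined off {2..k+1}. *)
definition words :: "nat \<Rightarrow> (nat \<Rightarrow> real) set" where
  "words k = {2..k + 1} \<rightarrow>\<^sub>E {0, 1}"

definition G :: "real \<Rightarrow> nat \<Rightarrow> (nat \<Rightarrow> real) \<Rightarrow> real^2 \<Rightarrow> real^2" where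
  "G q k u x = (\<Sum>h<k. mpow (A q) h *v vector [u (k + 1 - h), 0]) + mpow (A q) k *v x"

definition ifs :: "real \<Rightarrow> nat \<Rightarrow> (real^2 \<Rightarrow> real^2) set" where
  "ifs q k = G q k ` words k"

(* The Fibonacci sequence with f_0 = f_1 = 1 is f_j = fib (Suc j), as the library has fib 0 = 0.
   Both series converge for q > (1 + sqrt 5) / 2. *)
definition Q_inf :: "real \<Rightarrow> (real^2) set" where
  "Q_inf q =
    {vector [\<Sum>j. real (fib (Suc j)) / q^j * u j, \<Sum>j. real (fib (Suc j)) / q^j * u (Suc j)] | u.
       u \<in> UNIV \<rightarrow> {0, 1}}"

definition contraction :: "('a::metric_space \<Rightarrow> 'a) \<Rightarrow> bool" where
  "contraction g \<longleftrightarrow> (\<exists>c<1. \<forall>x y. dist (g x) (g y) \<le> c * dist x y)"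

definition hutchinson :: "('a \<Rightarrow> 'a) set \<Rightarrow> 'a set \<Rightarrow> 'a set" where
  "hutchinson F X = (\<Union>g\<in>F. g ` X)"

definition is_attractor :: "('a::metric_space \<Rightarrow> 'a) set \<Rightarrow> 'a set \<Rightarrow> bool" where
  "is_attractor F K \<longleftrightarrow>
     K \<noteq> {} \<and> compact K \<and> hutchinson F K = K \<and>
     (\<forall>L. L \<noteq> {} \<and> compact L \<and> hutchinson F L = L \<longrightarrow> L = K)"

definition hausdorff_dist :: "'a::metric_space set \<Rightarrow> 'a set \<Rightarrow> real" where
  "hausdorff_dist X Y = max (SUP x\<in>X. infdist x Y) (SUP y\<in>Y. infdist y X)"

(* Convergence in the metric space of non-empty compact sets; membership of all the sets in that
   space is required explicitly, since hausdorff_dist is junk on empty or unbounded sets. *)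
definition hausdorff_lim :: "(nat \<Rightarrow> 'a::metric_space set) \<Rightarrow> 'a set \<Rightarrow> bool" where
  "hausdorff_lim S K \<longleftrightarrow>
     (\<forall>n. S n \<noteq> {} \<and> compact (S n)) \<and> K \<noteq> {} \<and> compact K \<and>
     (\<lambda>n. hausdorff_dist (S n) K) \<longlonglongrightarrow> 0"

end

theory Submission
  imports Defs
begin

text \<open>
  Put \<open>S(u) = (\<Sum>\<^sub>j f\<^sub>j q\<^sup>-\<^sup>j u\<^sub>j, \<Sum>\<^sub>j f\<^sub>j q\<^sup>-\<^sup>j u\<^sub>j\<^sub>+\<^sub>1)\<close> for a binary sequence \<open>u\<close>, so that
  the limit set is the image of the Cantor space under \<open>S\<close>.  The Fibonacci recurrence says
  precisely that prepending a digit \<open>v\<close> to \<open>u\<close> turns \<open>S(u)\<close> into \<open>(v, 0) + A(q) S(u)\<close>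
  (\<open>expansion_point_prepend\<close>).  The map attached to a word of length \<open>k\<close> is the \<open>k\<close>-fold
  composition of such steps, hence it carries \<open>S(w)\<close> to \<open>S\<close> of the sequence that begins with the
  reversed word and goes on with \<open>w\<close> (\<open>G_expansion_point\<close>).  Since every binary sequence has a
  prefix of length \<open>k\<close>, the limit set is invariant under the Hutchinson operator.

  It is compact, because \<open>f\<^sub>j \<le> \<phi>\<^sup>j\<close> and \<open>q > \<phi>\<close> make the two series converge uniformly on the
  compact Cantor space, where each of their terms is continuous.

  Finally, all the maps have the same linear part \<open>A(q)\<^sup>k\<close>, of norm less than 1, so they are
  contractions with a common constant \<open>c\<close>.  The Hutchinson operator of such a family shrinks
  Hausdorff distances by the factor \<open>c\<close> (\<open>hausdorff_dist_hutchinson_le\<close>).  Thus its iterates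
  converge to any compact fixed set, and there is only one such set.
\<close>

section \<open>The Hausdorff distance and uniform contractions\<close>

lemma bdd_above_infdist_compact:
  assumes "compact X"
  shows "bdd_above ((\<lambda>x. infdist x Y) ` X)"
  using assms
  by (intro bounded_imp_bdd_above compact_imp_bounded compact_continuous_image
      continuous_on_infdist continuous_on_id)

lemma hausdorff_dist_commute: "hausdorff_dist X Y = hausdorff_dist Y X"
  by (simp add: hausdorff_dist_def max.commute)

lemma infdist_le_hausdorff_dist:
  assumes "compact X" "x \<in> X"
  shows "infdist x Y \<le> hausdorff_dist X Y"
proof -
  have "infdist x Y \<le> (SUP x\<in>X. infdist x Y)"
    using assms(2) bdd_above_infdist_compact[OF assms(1), of Y]
    by (rule cSUP_upper[where f = "\<lambda>x. infdist x Y"])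
  then show ?thesis
    by (simp add: hausdorff_dist_def)
qed

lemma hausdorff_dist_nonneg:
  assumes "compact X" "X \<noteq> {}"
  shows "0 \<le> hausdorff_dist X Y"
proof -
  obtain x where "x \<in> X"
    using assms(2) by blast
  then show ?thesis
    using infdist_le_hausdorff_dist[OF assms(1), of x Y] infdist_nonneg[of x Y] by linarith
qed

lemma hausdorff_dist_zero_imp_subset:
  assumes "compact X" "compact Y" "Y \<noteq> {}" "hausdorff_dist X Y = 0"
  shows "X \<subseteq> Y"
proof
  fix x assume "x \<in> X"
  then have "infdist x Y = 0"
    using infdist_le_hausdorff_dist[OF assms(1), of x Y] infdist_nonneg[of x Y] assms(4) by linarith
  then show "x \<in> Y"
    using in_closed_iff_infdist_zero[OF compact_imp_closed[OF assms(2)] assms(3)] by iprover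
qed

lemma hausdorff_dist_zero_imp_eq:
  assumes "compact X" "compact Y" "X \<noteq> {}" "Y \<noteq> {}" "hausdorff_dist X Y = 0"
  shows "X = Y"
  using hausdorff_dist_zero_imp_subset[OF assms(1,2,4,5)]
    hausdorff_dist_zero_imp_subset[OF assms(2,1,3)] assms(5)
  by (simp add: hausdorff_dist_commute equalityI)

lemma hutchinson_nonempty: "F \<noteq> {} \<Longrightarrow> X \<noteq> {} \<Longrightarrow> hutchinson F X \<noteq> {}"
  by (auto simp: hutchinson_def)

lemma compact_hutchinson:
  assumes "finite F" "\<And>g. g \<in> F \<Longrightarrow> continuous_on UNIV g" "compact X"
  shows "compact (hutchinson F X)"
  unfolding hutchinson_def
  using assms by (intro compact_UN compact_continuous_image) (auto intro: continuous_on_subset)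

text \<open>
  A point of \<open>X\<close> has a nearest point in the compact set \<open>Y\<close>; the same map of the family, applied
  to both, brings them closer by the factor \<open>c\<close>.
\<close>

lemma infdist_hutchinson_le:
  assumes lip: "\<And>g. g \<in> F \<Longrightarrow> c-lipschitz_on UNIV g"
    and X: "compact X" and Y: "compact Y" "Y \<noteq> {}" and z: "z \<in> hutchinson F X"
  shows "infdist z (hutchinson F Y) \<le> c * hausdorff_dist X Y"
proof -
  obtain g x where gx: "g \<in> F" "x \<in> X" "z = g x"
    using z by (auto simp: hutchinson_def)
  obtain y where y: "y \<in> Y" "\<And>y'. y' \<in> Y \<Longrightarrow> dist x y \<le> dist x y'"
    using continuous_attains_inf[OF Y continuous_on_dist[OF continuous_on_const continuous_on_id],
        of x] by auto
  then have dist_y: "dist x y \<le> infdist x Y"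
    unfolding infdist_notempty[OF Y(2)] by (intro cINF_greatest Y(2))
  have "infdist z (hutchinson F Y) \<le> dist (g x) (g y)"
    using gx(1) y(1) by (auto simp: gx(3) hutchinson_def intro!: infdist_le)
  also have "\<dots> \<le> c * dist x y"
    using lipschitz_onD[OF lip[OF gx(1)]] by simp
  also have "\<dots> \<le> c * hausdorff_dist X Y"
    using order_trans[OF dist_y infdist_le_hausdorff_dist[OF X gx(2)]]
      lipschitz_on_nonneg[OF lip[OF gx(1)]]
    by (rule mult_left_mono)
  finally show ?thesis .
qed

lemma hausdorff_dist_hutchinson_le:
  assumes lip: "\<And>g. g \<in> F \<Longrightarrow> c-lipschitz_on UNIV g"
    and "F \<noteq> {}" and X: "compact X" "X \<noteq> {}" and Y: "compact Y" "Y \<noteq> {}"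
  shows "hausdorff_dist (hutchinson F X) (hutchinson F Y) \<le> c * hausdorff_dist X Y"
  unfolding hausdorff_dist_def[of "hutchinson F X"]
proof (intro max.boundedI cSUP_least)
  show "infdist z (hutchinson F Y) \<le> c * hausdorff_dist X Y" if "z \<in> hutchinson F X" for z
    using infdist_hutchinson_le[OF lip X(1) Y that] .
  show "infdist z (hutchinson F X) \<le> c * hausdorff_dist X Y" if "z \<in> hutchinson F Y" for z
    using infdist_hutchinson_le[OF lip Y(1) X that] by (simp add: hausdorff_dist_commute)
qed (simp_all add: hutchinson_nonempty \<open>F \<noteq> {}\<close> X Y)

text \<open>
  Since \<open>K\<close> is fixed, each application of the Hutchinson operator multiplies the distance to \<open>K\<close>
  by at most \<open>c\<close>, so the distances decay geometrically.
\<close>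

lemma hausdorff_lim_hutchinson:
  fixes F :: "('a::metric_space \<Rightarrow> 'a) set"
  assumes F: "finite F" "F \<noteq> {}"
    and lip: "\<And>g. g \<in> F \<Longrightarrow> c-lipschitz_on UNIV g" and c: "c < 1"
    and K: "compact K" "K \<noteq> {}" "hutchinson F K = K"
    and X: "compact X" "X \<noteq> {}"
  shows "hausdorff_lim (\<lambda>n. (hutchinson F ^^ n) X) K"
proof -
  have c0: "0 \<le> c"
    using F(2) lip lipschitz_on_nonneg by blast
  have cont: "continuous_on UNIV g" if "g \<in> F" for g
    using lip[OF that] by (rule lipschitz_on_continuous_on)
  have iter: "compact ((hutchinson F ^^ n) X) \<and> (hutchinson F ^^ n) X \<noteq> {}" for n
    by (induction n) (simp_all add: X F cont compact_hutchinson hutchinson_nonempty)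
  have bound: "hausdorff_dist ((hutchinson F ^^ n) X) K \<le> c ^ n * hausdorff_dist X K" for n
  proof (induction n)
    case (Suc n)
    have "hausdorff_dist ((hutchinson F ^^ Suc n) X) K
        = hausdorff_dist (hutchinson F ((hutchinson F ^^ n) X)) (hutchinson F K)"
      using K(3) by simp
    also have "\<dots> \<le> c * hausdorff_dist ((hutchinson F ^^ n) X) K"
      using lip F(2) conjunct1[OF iter] conjunct2[OF iter] K(1,2)
      by (rule hausdorff_dist_hutchinson_le)
    also have "\<dots> \<le> c * (c ^ n * hausdorff_dist X K)"
      using Suc c0 by (rule mult_left_mono)
    finally show ?case by (simp add: mult.assoc)
  qed simp
  have "(\<lambda>n. c ^ n * hausdorff_dist X K) \<longlonglongrightarrow> 0"
    using c0 c by (intro tendsto_mult_left_zero LIMSEQ_realpow_zero)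
  then have "(\<lambda>n. hausdorff_dist ((hutchinson F ^^ n) X) K) \<longlonglongrightarrow> 0"
  proof (rule Lim_null_comparison[rotated], intro always_eventually allI)
    fix n
    have "0 \<le> hausdorff_dist ((hutchinson F ^^ n) X) K"
      by (rule hausdorff_dist_nonneg[OF conjunct1[OF iter] conjunct2[OF iter]])
    then show "norm (hausdorff_dist ((hutchinson F ^^ n) X) K) \<le> c ^ n * hausdorff_dist X K"
      unfolding real_norm_def using bound[of n] by linarith
  qed
  then show ?thesis
    unfolding hausdorff_lim_def using iter K(1,2) by iprover
qed

text \<open>
  Uniqueness is a special case of convergence: the iterates of a fixed set \<open>L\<close> stay at \<open>L\<close>, so
  their constant distance to \<open>K\<close> tends to 0.
\<close>

lemma is_attractor_if_uniform_contraction: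
  fixes F :: "('a::metric_space \<Rightarrow> 'a) set"
  assumes F: "finite F" "F \<noteq> {}"
    and lip: "\<And>g. g \<in> F \<Longrightarrow> c-lipschitz_on UNIV g" and c: "c < 1"
    and K: "compact K" "K \<noteq> {}" "hutchinson F K = K"
  shows "is_attractor F K"
proof -
  have "L = K" if L: "L \<noteq> {}" "compact L" "hutchinson F L = L" for L
  proof -
    have "(hutchinson F ^^ n) L = L" for n
      using L(3) by (induction n) auto
    then have "(\<lambda>n::nat. hausdorff_dist L K) \<longlonglongrightarrow> 0"
      using hausdorff_lim_hutchinson[OF F lip c K L(2,1)] by (simp add: hausdorff_lim_def)
    then have "hausdorff_dist L K = 0"
      by (simp add: LIMSEQ_const_iff)
    then show ?thesis
      by (rule hausdorff_dist_zero_imp_eq[OF L(2) K(1) L(1) K(2)])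
  qed
  then show ?thesis
    unfolding is_attractor_def using K by iprover
qed

section \<open>Fibonacci expansions of binary sequences\<close>

definition binary_seqs :: "(nat \<Rightarrow> real) set" where
  "binary_seqs = UNIV \<rightarrow> {0, 1}"

definition expansion :: "real \<Rightarrow> (nat \<Rightarrow> real) \<Rightarrow> real" where
  "expansion q u = (\<Sum>j. real (fib (Suc j)) / q ^ j * u j)"

definition expansion_point :: "real \<Rightarrow> (nat \<Rightarrow> real) \<Rightarrow> real^2" where
  "expansion_point q u = vector [expansion q u, expansion q (\<lambda>j. u (Suc j))]"

lemma Q_inf_eq: "Q_inf q = expansion_point q ` binary_seqs"
  unfolding Q_inf_def binary_seqs_def expansion_point_def expansion_def by blast

lemma golden_ratio_pos: "0 < (1 + sqrt 5) / 2"
  by (simp add: add_pos_pos)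

lemma gt_golden_imp_pos: "q > (1 + sqrt 5) / 2 \<Longrightarrow> 0 < q"
  using golden_ratio_pos by (rule less_trans)

lemma fib_le_golden_power: "real (fib (Suc j)) \<le> ((1 + sqrt 5) / 2) ^ j"
proof (induction j rule: fib.induct)
  case (3 n)
  define p where "p = (1 + sqrt 5) / 2"
  have "p\<^sup>2 = p + 1"
    by (simp add: p_def power2_eq_square field_simps)
  then have "p ^ n * p\<^sup>2 = p ^ n * (p + 1)"
    by simp
  then have "p ^ Suc (Suc n) = p ^ Suc n + p ^ n"
    by (simp add: power2_eq_square algebra_simps)
  then show ?case
    using 3 by (simp flip: p_def)
qed auto

lemma summable_fib_over_power:
  assumes "q > (1 + sqrt 5) / 2"
  shows "summable (\<lambda>j. real (fib (Suc j)) / q ^ j)"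
proof (rule summable_comparison_test')
  have "0 < q"
    using assms(1) by (rule gt_golden_imp_pos)
  then show "norm (real (fib (Suc j)) / q ^ j) \<le> ((1 + sqrt 5) / 2 / q) ^ j" for j
    using divide_right_mono[OF fib_le_golden_power, of "q ^ j" j]
    by (simp add: power_divide del: fib.simps)
  show "summable (\<lambda>j. ((1 + sqrt 5) / 2 / q) ^ j)"
    using assms \<open>0 < q\<close> golden_ratio_pos by (intro summable_geometric) simp
qed

lemma in_binary_seqs_iff: "u \<in> binary_seqs \<longleftrightarrow> (\<forall>j. u j = 0 \<or> u j = 1)"
  by (auto simp: binary_seqs_def Pi_iff)

lemma norm_expansion_term_le:
  assumes "q > (1 + sqrt 5) / 2" "u \<in> binary_seqs"
  shows "norm (real (fib (Suc j)) / q ^ j * u j) \<le> real (fib (Suc j)) / q ^ j"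
proof -
  have "0 < q"
    using assms(1) by (rule gt_golden_imp_pos)
  then show ?thesis
    using spec[OF iffD1[OF in_binary_seqs_iff assms(2)], of j] by (auto simp del: fib.simps)
qed

lemma summable_expansion:
  assumes "q > (1 + sqrt 5) / 2" "u \<in> binary_seqs"
  shows "summable (\<lambda>j. real (fib (Suc j)) / q ^ j * u j)"
  using summable_fib_over_power[OF assms(1)] norm_expansion_term_le[OF assms]
  by (rule summable_comparison_test')

lemma shift_binary_seqs: "u \<in> binary_seqs \<Longrightarrow> (\<lambda>j. u (Suc j)) \<in> binary_seqs"
  by (simp add: in_binary_seqs_iff)

text \<open>
  Splitting \<open>f\<^sub>j\<^sub>+\<^sub>1 = f\<^sub>j + f\<^sub>j\<^sub>-\<^sub>1\<close> in the coefficients of the tail gives the first row of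
  \<open>A(q)\<close>; the extra factor \<open>1 / q\<close> of its second entry comes from reindexing the sum over
  \<open>f\<^sub>j\<^sub>-\<^sub>1\<close>, whose term for \<open>j = 0\<close> vanishes.
\<close>

lemma expansion_prepend:
  assumes q: "q > (1 + sqrt 5) / 2" and u: "u \<in> binary_seqs" and v: "v \<in> {0, 1}"
  shows "expansion q (case_nat v u)
    = v + (1 / q * expansion q u + 1 / q\<^sup>2 * expansion q (\<lambda>j. u (Suc j)))"
proof -
  have "0 < q"
    using gt_golden_imp_pos[OF q] .
  let ?a = "\<lambda>j. real (fib (Suc j)) / q ^ j"
  let ?b = "\<lambda>j. real (fib j) / q ^ Suc j * u j"
  have vu: "case_nat v u \<in> binary_seqs"
    using u v by (auto simp: in_binary_seqs_iff split: nat.split)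
  have s0: "(\<lambda>j. 1 / q * (?a j * u j)) sums (1 / q * expansion q u)"
    unfolding expansion_def by (intro sums_mult summable_sums summable_expansion q u)
  have "(\<lambda>j. 1 / q\<^sup>2 * (?a j * u (Suc j))) sums (1 / q\<^sup>2 * expansion q (\<lambda>j. u (Suc j)))"
    unfolding expansion_def
    by (intro sums_mult summable_sums summable_expansion[OF q shift_binary_seqs[OF u]])
  moreover have "1 / q\<^sup>2 * (?a j * u (Suc j)) = ?b (Suc j)" for j
    by (simp add: power2_eq_square)
  ultimately have "(\<lambda>j. ?b (Suc j)) sums (1 / q\<^sup>2 * expansion q (\<lambda>j. u (Suc j)))"
    by (simp only:)
  then have "?b sums (1 / q\<^sup>2 * expansion q (\<lambda>j. u (Suc j)) + ?b 0)"
    by (rule sums_Suc[where f = ?b])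
  then have s1: "?b sums (1 / q\<^sup>2 * expansion q (\<lambda>j. u (Suc j)))"
    by simp
  have "(\<lambda>j. 1 / q * (?a j * u j) + ?b j)
      sums (1 / q * expansion q u + 1 / q\<^sup>2 * expansion q (\<lambda>j. u (Suc j)))"
    using s0 s1 by (rule sums_add)
  moreover have "1 / q * (?a j * u j) + ?b j = ?a (Suc j) * case_nat v u (Suc j)" for j
    using \<open>0 < q\<close> by (simp add: field_simps)
  ultimately have "(\<lambda>j. ?a (Suc j) * case_nat v u (Suc j))
      sums (1 / q * expansion q u + 1 / q\<^sup>2 * expansion q (\<lambda>j. u (Suc j)))"
    by simp
  then have "(\<lambda>j. ?a j * case_nat v u j)
      sums (1 / q * expansion q u + 1 / q\<^sup>2 * expansion q (\<lambda>j. u (Suc j)) + v)"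
    by (subst (asm) sums_Suc_iff) simp
  then show ?thesis
    unfolding expansion_def by (simp add: sums_iff add.commute)
qed

lemma A_mult_vector: "A q *v vector [a, b] = vector [1 / q * a + 1 / q\<^sup>2 * b, a]"
  by (simp add: A_def vec_eq_iff forall_2 matrix_vector_mult_def sum_2)

lemma expansion_point_prepend:
  assumes "q > (1 + sqrt 5) / 2" "u \<in> binary_seqs" "v \<in> {0, 1}"
  shows "expansion_point q (case_nat v u) = vector [v, 0] + A q *v expansion_point q u"
  unfolding expansion_point_def A_mult_vector expansion_prepend[OF assms]
  by (simp add: vec_eq_iff forall_2)

section \<open>Compactness of the limit set\<close>

lemma compact_binary_seqs: "compact binary_seqs"
proof -
  have "compactin (product_topology (\<lambda>i::nat. euclidean :: real topology) UNIV)
      (\<Pi>\<^sub>E i\<in>UNIV. {0, 1})"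
    by (subst compactin_PiE) simp
  then show ?thesis
    by (simp add: euclidean_product_topology binary_seqs_def PiE_UNIV_domain Pi_def)
qed

lemma continuous_on_expansion:
  assumes "q > (1 + sqrt 5) / 2"
  shows "continuous_on binary_seqs (expansion q)"
proof (rule uniform_limit_theorem)
  show "uniform_limit binary_seqs (\<lambda>n u. \<Sum>j<n. real (fib (Suc j)) / q ^ j * u j)
      (expansion q) sequentially"
    unfolding expansion_def
    using norm_expansion_term_le[OF assms] summable_fib_over_power[OF assms]
    by (rule Weierstrass_m_test)
  show "\<forall>\<^sub>F n in sequentially.
      continuous_on binary_seqs (\<lambda>u. \<Sum>j<n. real (fib (Suc j)) / q ^ j * u j)"
    by (intro always_eventually allI continuous_intros
        continuous_on_subset[OF continuous_on_product_coordinates]) auto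
qed simp

lemma compact_Q_inf:
  assumes "q > (1 + sqrt 5) / 2"
  shows "compact (Q_inf q)"
proof -
  have "continuous_on binary_seqs (\<lambda>u j. u (Suc j) :: real)"
    by (intro continuous_on_coordinatewise_then_product
        continuous_on_subset[OF continuous_on_product_coordinates]) auto
  moreover have "(\<lambda>u j. u (Suc j)) ` binary_seqs \<subseteq> binary_seqs"
    using shift_binary_seqs by blast
  ultimately have "continuous_on binary_seqs (\<lambda>u. expansion q (\<lambda>j. u (Suc j)))"
    by (rule continuous_on_compose2[OF continuous_on_expansion[OF assms]])
  then have "continuous_on binary_seqs
      (\<lambda>u. if i = 1 then expansion q u else expansion q (\<lambda>j. u (Suc j)))" for i :: 2
    using continuous_on_expansion[OF assms] by (cases "i = 1") simp_all
  then have "continuous_on binary_seqs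
      (\<lambda>u. \<chi> i::2. if i = 1 then expansion q u else expansion q (\<lambda>j. u (Suc j)))"
    by (rule continuous_on_vec_lambda)
  moreover have "expansion_point q
      = (\<lambda>u. \<chi> i::2. if i = 1 then expansion q u else expansion q (\<lambda>j. u (Suc j)))"
    by (simp add: expansion_point_def fun_eq_iff vec_eq_iff forall_2)
  ultimately show ?thesis
    using compact_binary_seqs by (simp add: Q_inf_eq compact_continuous_image)
qed

lemma Q_inf_nonempty: "Q_inf q \<noteq> {}"
  by (auto simp: Q_inf_eq binary_seqs_def Pi_eq_empty)

section \<open>The iterated function system\<close>

lemma finite_words: "finite (words k)"
  by (simp add: words_def finite_PiE)

lemma words_nonempty: "words k \<noteq> {}"
  by (simp add: words_def PiE_eq_empty_iff)

lemma G_0: "G q 0 u x = x"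
  by (simp add: G_def)

lemma G_Suc: "G q (Suc k) u x = vector [u (k + 2), 0] + A q *v G q k u x"
proof -
  have "(\<Sum>h<Suc k. mpow (A q) h *v vector [u (Suc k + 1 - h), 0])
      = vector [u (k + 2), 0] + A q *v (\<Sum>h<k. mpow (A q) h *v vector [u (k + 1 - h), 0])"
    unfolding sum.lessThan_Suc_shift linear_sum[OF matrix_vector_mul_linear]
    by (simp add: matrix_vector_mul_assoc)
  then show ?thesis
    by (simp add: G_def matrix_vector_right_distrib matrix_vector_mul_assoc add.assoc)
qed

lemma reversed_word_append_in_binary_seqs:
  assumes "w \<in> binary_seqs" "\<And>i. i \<in> {2..k + 1} \<Longrightarrow> u i \<in> {0, 1}"
  shows "(\<lambda>j. if j < k then u (k + 1 - j) else w (j - k)) \<in> binary_seqs"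
  unfolding in_binary_seqs_iff
proof
  fix j
  show "(if j < k then u (k + 1 - j) else w (j - k)) = 0 \<or>
      (if j < k then u (k + 1 - j) else w (j - k)) = 1"
    using assms(1) assms(2)[of "k + 1 - j"] by (auto simp: in_binary_seqs_iff)
qed

text \<open>
  The digits \<open>u\<^sub>2, \<dots>, u\<^sub>k\<^sub>+\<^sub>1\<close> are prepended to \<open>w\<close> one after the other, so the last of them
  ends up in front.
\<close>

lemma G_expansion_point:
  assumes "q > (1 + sqrt 5) / 2" "w \<in> binary_seqs" "\<And>i. i \<in> {2..k + 1} \<Longrightarrow> u i \<in> {0, 1}"
  shows "G q k u (expansion_point q w)
    = expansion_point q (\<lambda>j. if j < k then u (k + 1 - j) else w (j - k))"
  using assms(3)
proof (induction k)
  case 0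
  then show ?case by (simp add: G_0)
next
  case (Suc k)
  let ?s = "\<lambda>j. if j < k then u (k + 1 - j) else w (j - k)"
  have s: "?s \<in> binary_seqs"
    using Suc.prems by (intro reversed_word_append_in_binary_seqs assms(2)) auto
  have "G q (Suc k) u (expansion_point q w) = vector [u (k + 2), 0] + A q *v expansion_point q ?s"
    using Suc by (simp add: G_Suc)
  also have "\<dots> = expansion_point q (case_nat (u (k + 2)) ?s)"
    using Suc.prems by (intro expansion_point_prepend[symmetric] assms(1) s) auto
  also have "case_nat (u (k + 2)) ?s
      = (\<lambda>j. if j < Suc k then u (Suc k + 1 - j) else w (j - Suc k))"
    by (auto simp: fun_eq_iff split: nat.split)
  finally show ?case .
qed

lemma hutchinson_ifs: "hutchinson (ifs q k) X = (\<Union>u\<in>words k. G q k u ` X)"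
  by (simp add: hutchinson_def ifs_def)

lemma hutchinson_ifs_Q_inf:
  assumes q: "q > (1 + sqrt 5) / 2"
  shows "hutchinson (ifs q k) (Q_inf q) = Q_inf q"
proof (intro equalityI subsetI)
  fix z assume "z \<in> hutchinson (ifs q k) (Q_inf q)"
  then obtain u w where u: "u \<in> words k" and w: "w \<in> binary_seqs"
    and z: "z = G q k u (expansion_point q w)"
    by (auto simp: hutchinson_ifs Q_inf_eq)
  have u01: "u i \<in> {0, 1}" if "i \<in> {2..k + 1}" for i
    using u that by (auto simp: words_def)
  have "z = expansion_point q (\<lambda>j. if j < k then u (k + 1 - j) else w (j - k))"
    unfolding z using q w u01 by (rule G_expansion_point)
  moreover have "(\<lambda>j. if j < k then u (k + 1 - j) else w (j - k)) \<in> binary_seqs"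
    using w u01 by (rule reversed_word_append_in_binary_seqs)
  ultimately show "z \<in> Q_inf q"
    by (simp add: Q_inf_eq)
next
  fix z assume "z \<in> Q_inf q"
  then obtain v where v: "v \<in> binary_seqs" and z: "z = expansion_point q v"
    by (auto simp: Q_inf_eq)
  \<comment> \<open>The word is the prefix of \<open>v\<close> of length \<open>k\<close>, read backwards.\<close>
  define u where "u = (\<lambda>i\<in>{2..k + 1}. v (k + 1 - i))"
  define w where "w = (\<lambda>j. v (j + k))"
  have u: "u \<in> words k" and w: "w \<in> binary_seqs"
    using v by (auto simp: u_def w_def words_def binary_seqs_def)
  have u01: "u i \<in> {0, 1}" if "i \<in> {2..k + 1}" for i
    using u that by (auto simp: words_def)
  have "(\<lambda>j. if j < k then u (k + 1 - j) else w (j - k)) = v"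
    by (auto simp: fun_eq_iff u_def w_def)
  then have "z = G q k u (expansion_point q w)"
    using G_expansion_point[OF q w u01] z by simp
  then show "z \<in> hutchinson (ifs q k) (Q_inf q)"
    using u w by (auto simp: hutchinson_ifs Q_inf_eq)
qed

text \<open>The constant does not depend on the word, as \<open>u\<close> enters only the translation part.\<close>

lemma lipschitz_on_G: "(onorm (\<lambda>x. mpow (A q) k *v x))-lipschitz_on UNIV (G q k u)"
proof (rule lipschitz_onI)
  fix x y
  have "G q k u x - G q k u y = mpow (A q) k *v (x - y)"
    by (simp add: G_def matrix_vector_mult_diff_distrib)
  then show "dist (G q k u x) (G q k u y) \<le> onorm (\<lambda>x. mpow (A q) k *v x) * dist x y"
    using onorm[OF matrix_vector_mul_bounded_linear[of "mpow (A q) k"], of "x - y"]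
    by (simp add: dist_norm)
qed (rule onorm_pos_le[OF matrix_vector_mul_bounded_linear])

theorem theorem26:
  fixes q :: real and kq k :: nat
  assumes "q > (1 + sqrt 5) / 2"
    and "kq > 0"
    and "\<forall>m\<ge>kq. onorm (\<lambda>x. mpow (A q) m *v x) < 1"
    and "k \<ge> kq"
  shows "(\<forall>u\<in>words k. contraction (G q k u)) \<and>
    (\<Union>u\<in>words k. G q k u ` Q_inf q) = Q_inf q \<and>
    is_attractor (ifs q k) (Q_inf q) \<and>
    (\<forall>X. X \<noteq> {} \<and> compact X \<longrightarrow>
       hausdorff_lim (\<lambda>n. (hutchinson (ifs q k) ^^ n) X) (Q_inf q))"
proof -
  let ?c = "onorm (\<lambda>x. mpow (A q) k *v x)"
  have c: "?c < 1"
    using assms(3,4) by blast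
  have lip: "?c-lipschitz_on UNIV g" if "g \<in> ifs q k" for g
    using that lipschitz_on_G by (auto simp: ifs_def)
  have F: "finite (ifs q k)" "ifs q k \<noteq> {}"
    by (simp_all add: ifs_def finite_words words_nonempty)
  note K = compact_Q_inf[OF assms(1)] Q_inf_nonempty hutchinson_ifs_Q_inf[OF assms(1)]
  have "contraction (G q k u)" for u
    unfolding contraction_def using c lipschitz_onD[OF lipschitz_on_G UNIV_I UNIV_I] by blast
  moreover have "(\<Union>u\<in>words k. G q k u ` Q_inf q) = Q_inf q"
    using K(3) by (simp add: hutchinson_ifs)
  moreover have "is_attractor (ifs q k) (Q_inf q)"
    using F lip c K by (rule is_attractor_if_uniform_contraction)
  moreover have "hausdorff_lim (\<lambda>n. (hutchinson (ifs q k) ^^ n) X) (Q_inf q)"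
    if "X \<noteq> {}" "compact X" for X
    using F lip c K that(2,1) by (rule hausdorff_lim_hutchinson)
  ultimately show ?thesis
    by blast
qed

end
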